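(* Let $\mu>-1$, $q>-1$, $0<\gamma<1$, and $0\le\eta<1-\gamma$. Let $w\in\mathcal A_q(\eta)$, i.e. $w:(0,\infty)\to(0,\infty)$ is positive, finite, measurable and $$\frac{w(t)}{t^q}\le e^{\eta(x-t)}\,\frac{w(x)}{x^q},\qquad 0<t\le x<\infty.$$ Then for every $\theta$ with $\gamma+\eta<\theta<1$ and all $x>0$, $$\int_0^x e^{-\gamma t}w(t)t^{-\mu}I_\mu(t)\,dt\le M^{(\eta)}_{\mu,q,\gamma}(\theta)\,e^{-\gamma x}w(x)x^{-\mu}I_{\mu+1}(x),$$ where $$M^{(\eta)}_{\mu,q,\gamma}(\theta)=\max\left\{K_{\mu,q}\exp\left((\gamma+\eta)X_{\mu,q}(\theta)\right),\ \frac{1}{\beta_{\mu,q}(\theta)(\theta-\gamma-\eta)}\right\}.$$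
   Context: $I_\alpha(x)=\sum_{k=0}^{\infty}\frac{(x/2)^{2k+\alpha}}{k!\,\Gamma(k+\alpha+1)}$, $x>0$, is the modified Bessel function of the first kind. For $\mu>-1$, $q>-1$, $0<\theta<1$: $K_{\mu,q}=\max\{1,\frac{2(\mu+1)}{q+1}\}$; $X_{\mu,q}(\theta)=\frac{2(\mu+2)\theta}{1-\theta}$ if $q\ge0$, and if $-1<q<0$, $$X_{\mu,q}(\theta)=\max\left\{\frac{2(\mu+2)\theta}{1-\theta},\ \frac{(2\mu+2)\theta-q+\sqrt{\{(2\mu+2)\theta-q\}^2-4(1-\theta)q(2\mu+2)}}{2(1-\theta)}\right\};$$ $\beta_{\mu,q}(\theta)=\frac{X_{\mu,q}(\theta)}{X_{\mu,q}(\theta)+2\mu+2}$. *)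

theory Defs
  imports "HOL-Analysis.Analysis"
begin

definition Bessel_I :: "real \<Rightarrow> real \<Rightarrow> real" where
  "Bessel_I \<alpha> x =
     (\<Sum>k. (x / 2) powr (2 * real k + \<alpha>) / (fact k * Gamma (real k + \<alpha> + 1)))"

(* Weights on (0,\<infinity>) are total functions on the reals whose values outside (0,\<infinity>) are
   irrelevant. Measurability is Lebesgue measurability on (0,\<infinity>). *)
definition weight_class :: "real \<Rightarrow> real \<Rightarrow> (real \<Rightarrow> real) set" where
  "weight_class q \<eta> =
     {w. w \<in> borel_measurable (lebesgue_on {0<..}) \<and>
         (\<forall>t>0. w t > 0) \<and>
         (\<forall>t x. 0 < t \<and> t \<le> x \<longrightarrow>
            w t / t powr q \<le> exp (\<eta> * (x - t)) * (w x / x powr q))}"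

definition K_const :: "real \<Rightarrow> real \<Rightarrow> real" where
  "K_const \<mu> q = max 1 (2 * (\<mu> + 1) / (q + 1))"

definition X_fun :: "real \<Rightarrow> real \<Rightarrow> real \<Rightarrow> real" where
  "X_fun \<mu> q \<theta> =
     (if q \<ge> 0 then 2 * (\<mu> + 2) * \<theta> / (1 - \<theta>)
      else max (2 * (\<mu> + 2) * \<theta> / (1 - \<theta>))
             (((2 * \<mu> + 2) * \<theta> - q
                + sqrt (((2 * \<mu> + 2) * \<theta> - q)\<^sup>2 - 4 * (1 - \<theta>) * q * (2 * \<mu> + 2)))
              / (2 * (1 - \<theta>))))"

definition beta_fun :: "real \<Rightarrow> real \<Rightarrow> real \<Rightarrow> real" where
  "beta_fun \<mu> q \<theta> = X_fun \<mu> q \<theta> / (X_fun \<mu> q \<theta> + 2 * \<mu> + 2)"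

definition M_const :: "real \<Rightarrow> real \<Rightarrow> real \<Rightarrow> real \<Rightarrow> real \<Rightarrow> real" where
  "M_const \<eta> \<mu> q \<gamma> \<theta> =
     max (K_const \<mu> q * exp ((\<gamma> + \<eta>) * X_fun \<mu> q \<theta>))
         (1 / (beta_fun \<mu> q \<theta> * (\<theta> - \<gamma> - \<eta>)))"

end

theory Submission
  imports Defs
begin

text \<open>
  The weight condition lets \<open>w t\<close> be replaced by \<open>t powr q\<close>: for \<open>t \<le> x\<close> it bounds \<open>w t\<close> by
  \<open>exp (\<eta> * (x - t)) * w x * (t / x) powr q\<close>, and the exponential joins \<open>exp (- \<gamma> * t)\<close>. With
  \<open>a = \<gamma> + \<eta>\<close>, both sides carry the same factor, and it remains to bound the integral of
  \<open>exp (- a * t) * t powr (q - \<mu>) * Bessel_I \<mu> t\<close> over \<open>(0,x)\<close> by \<open>M * G a x\<close>, where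
  \<open>G a t = exp (- a * t) * t powr (q - \<mu>) * Bessel_I (\<mu> + 1) t\<close>.

  Since \<open>q > -1\<close>, \<open>G a\<close> extends continuously by \<open>0\<close> to the origin, so such a bound follows from
  the pointwise bound of the integrand by \<open>M * (G a)'\<close>. Here \<open>(G a)' t\<close> is
  \<open>exp (- a * t) * t powr (q - \<mu>)\<close> times
  \<open>Bessel_I (\<mu> + 2) t + ((q + 1) / t - a) * Bessel_I (\<mu> + 1) t\<close>, which is to be compared with
  \<open>Bessel_I \<mu> t = Bessel_I (\<mu> + 2) t + 2 * (\<mu> + 1) / t * Bessel_I (\<mu> + 1) t\<close>. For
  bounded \<open>t\<close> the negative term is avoided by estimating the exponential factor by a constant;
  for large \<open>t\<close> it is absorbed, because \<open>a < \<theta>\<close>. The two terms of the maximum defining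
  \<open>M\<close> come from these two regimes, separated at \<open>X = X_fun \<mu> q \<theta>\<close>.

  Up to \<open>X\<close> the exponential is dropped: comparing the two expressions at \<open>a = 0\<close>
  coefficient by coefficient gives the constant \<open>K_const \<mu> q\<close>
  (\<open>nn_integral_power_weight_small\<close>), and putting the exponential back costs at
  most \<open>exp (a * X)\<close>.

  Beyond \<open>X\<close> consecutive orders are comparable: \<open>Bessel_I (\<nu> + 1) t\<close> is at least
  \<open>t / (t + 2 * \<nu> + 2)\<close> times \<open>Bessel_I \<nu> t\<close> (\<open>Bessel_I_ratio_lower\<close>). The choice of \<open>X\<close>
  makes this factor at least \<open>\<theta>\<close> for \<open>\<nu> = \<mu> + 1\<close>, and at least \<open>beta_fun \<mu> q \<theta>\<close> for
  \<open>\<nu> = \<mu>\<close>. Hence the second factor of \<open>(G a)'\<close> is at least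
  \<open>(\<theta> - a) * Bessel_I (\<mu> + 1) t\<close>, which is at least
  \<open>(\<theta> - a) * beta_fun \<mu> q \<theta> * Bessel_I \<mu> t\<close>
  (\<open>exp_powr_Bessel_I_derivative_bound\<close>).

  The ratio bound is, by the recurrence, equivalent to the decrease of \<open>Bessel_I \<alpha> t\<close> when a
  positive order \<open>\<alpha>\<close> grows by one, which follows from the differential relations.
\<close>

section \<open>The modified Bessel function\<close>

text \<open>
  The entire factor of \<open>Bessel_I\<close>: separating the power \<open>(x / 2) powr \<alpha>\<close> and writing the rest as a
  power series in \<open>z = (x / 2)\<^sup>2\<close> makes termwise differentiation and the behaviour at the
  origin available from the theory of power series.
\<close>
definition Bessel_series :: "real \<Rightarrow> real \<Rightarrow> real" where
  "Bessel_series \<alpha> z = (\<Sum>k. 1 / (fact k * Gamma (real k + \<alpha> + 1)) * z ^ k)"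

lemma summable_Bessel_series:
  fixes \<alpha> z :: real
  assumes "\<alpha> > -1"
  shows "summable (\<lambda>k. 1 / (fact k * Gamma (real k + \<alpha> + 1)) * z ^ k)"
proof -
  define f where "f = (\<lambda>k. 1 / (fact k * Gamma (real k + \<alpha> + 1)) * z ^ k)"
  \<comment> \<open>From here on \<open>real k \<ge> 2 * \<bar>z\<bar>\<close>, and \<open>real k \<ge> 1\<close>, which makes \<open>real k + \<alpha> + 1 \<ge> 1\<close>.\<close>
  define N where "N = nat \<lceil>2 * \<bar>z\<bar>\<rceil> + 1"
  have "norm (f (Suc k)) \<le> 1 / 2 * norm (f k)" if k: "k \<ge> N" for k
  proof -
    have N: "real k \<ge> 2 * \<bar>z\<bar>" "real k \<ge> 1"
      using k unfolding N_def by linarith+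
    have pos: "real k + \<alpha> + 1 > 0" using assms by simp
    have "Gamma (real (Suc k) + \<alpha> + 1) = (real k + \<alpha> + 1) * Gamma (real k + \<alpha> + 1)"
      using Gamma_plus1[of "real k + \<alpha> + 1"] pos
      by (auto simp: algebra_simps nonpos_Ints_def)
    then have eq: "f (Suc k) = z / ((real k + 1) * (real k + \<alpha> + 1)) * f k"
      by (simp add: f_def field_simps)
    have "2 * \<bar>z\<bar> \<le> (real k + 1) * 1" using N by simp
    also have "\<dots> \<le> (real k + 1) * (real k + \<alpha> + 1)"
      by (rule mult_left_mono) (use N assms in simp_all)
    finally have "2 * \<bar>z\<bar> \<le> (real k + 1) * (real k + \<alpha> + 1)" .
    moreover have "0 < (real k + 1) * (real k + \<alpha> + 1)" using pos by simp
    ultimately have "norm (z / ((real k + 1) * (real k + \<alpha> + 1))) \<le> 1 / 2"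
      by (simp only: real_norm_def abs_divide abs_of_pos pos_divide_le_eq)
    then show ?thesis unfolding eq norm_mult by (rule mult_right_mono) simp
  qed
  then have "summable f" by (intro summable_ratio_test[of "1/2" N]) auto
  then show ?thesis unfolding f_def .
qed

lemma Bessel_series_pos:
  fixes \<alpha> z :: real
  assumes "\<alpha> > -1" "z \<ge> 0"
  shows "Bessel_series \<alpha> z > 0"
  unfolding Bessel_series_def
proof (rule suminf_pos2[OF summable_Bessel_series[OF assms(1)], where i = 0])
  have g: "Gamma (real k + \<alpha> + 1) > 0" for k using assms by (intro Gamma_real_pos) simp
  then show "0 \<le> 1 / (fact k * Gamma (real k + \<alpha> + 1)) * z ^ k" for k
    using assms(2) less_imp_le[OF g[of k]] by simp
  show "0 < 1 / (fact 0 * Gamma (real 0 + \<alpha> + 1)) * z ^ 0" using g[of 0] by simp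
qed

lemma DERIV_Bessel_series:
  fixes \<alpha> z :: real
  assumes "\<alpha> > -1"
  shows "(Bessel_series \<alpha> has_real_derivative Bessel_series (\<alpha> + 1) z) (at z)"
proof -
  have "diffs (\<lambda>k. 1 / (fact k * Gamma (real k + \<alpha> + 1)))
      = (\<lambda>k. 1 / (fact k * Gamma (real k + (\<alpha> + 1) + 1)))"
    by (auto simp: fun_eq_iff diffs_def add_ac divide_simps)
  then show ?thesis
    using termdiffs_strong_converges_everywhere[OF summable_Bessel_series[OF assms], of z]
    unfolding Bessel_series_def[abs_def] by simp
qed

text \<open>
  Write the coefficient \<open>1 / (k! \<Gamma>(k + \<alpha> + 1))\<close> as \<open>(k + \<alpha> + 1) / (k! \<Gamma>(k + \<alpha> + 2))\<close>. The
  part \<open>\<alpha> + 1\<close> of the numerator gives the first series; the part \<open>k\<close> cancels against the factorial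
  and gives the second one, shifted by one.
\<close>
lemma Bessel_series_recurrence:
  fixes \<alpha> z :: real
  assumes "\<alpha> > -1"
  shows "Bessel_series \<alpha> z = (\<alpha> + 1) * Bessel_series (\<alpha> + 1) z + z * Bessel_series (\<alpha> + 2) z"
proof -
  let ?c = "\<lambda>\<alpha> k. 1 / (fact k * Gamma (real k + \<alpha> + 1)) :: real"
  have s: "(\<lambda>k. ?c \<beta> k * z ^ k) sums Bessel_series \<beta> z" if "\<beta> > -1" for \<beta>
    unfolding Bessel_series_def by (rule summable_sums[OF summable_Bessel_series[OF that]])
  \<comment> \<open>The coefficients of \<open>z * Bessel_series (\<alpha> + 2) z\<close>, indexed by the power of \<open>z\<close>.\<close>
  define b where "b k = (case k of 0 \<Rightarrow> 0 | Suc j \<Rightarrow> z * (?c (\<alpha> + 2) j * z ^ j))" for k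
  have "(\<lambda>j. b (Suc j)) sums (z * Bessel_series (\<alpha> + 2) z)"
    unfolding b_def using sums_mult[OF s[of "\<alpha> + 2"], of z] assms by simp
  then have "b sums (z * Bessel_series (\<alpha> + 2) z)"
    using sums_Suc_iff[of b "z * Bessel_series (\<alpha> + 2) z"] by (simp add: b_def)
  with sums_mult[OF s[of "\<alpha> + 1"], of "\<alpha> + 1"] assms
  have "(\<lambda>k. (\<alpha> + 1) * (?c (\<alpha> + 1) k * z ^ k) + b k) sums
      ((\<alpha> + 1) * Bessel_series (\<alpha> + 1) z + z * Bessel_series (\<alpha> + 2) z)"
    by (intro sums_add) simp_all
  moreover have "(\<alpha> + 1) * (?c (\<alpha> + 1) k * z ^ k) + b k = ?c \<alpha> k * z ^ k" for k
  proof -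
    have pos: "real k + \<alpha> + 1 > 0" using assms by simp
    have G: "Gamma (real k + \<alpha> + 2) = (real k + \<alpha> + 1) * Gamma (real k + \<alpha> + 1)"
      using Gamma_plus1[of "real k + \<alpha> + 1"] pos
      by (auto simp: algebra_simps nonpos_Ints_def)
    have nz: "Gamma (real k + \<alpha> + 1) \<noteq> 0" using Gamma_real_pos[OF pos] by simp
    have c: "?c (\<alpha> + 1) k * (real k + \<alpha> + 1) = ?c \<alpha> k"
      using G pos nz by (simp add: add_ac)
    have "b k = real k * (?c (\<alpha> + 1) k * z ^ k)"
      by (cases k) (simp_all add: b_def add_ac)
    then have "(\<alpha> + 1) * (?c (\<alpha> + 1) k * z ^ k) + b k
        = (?c (\<alpha> + 1) k * (real k + \<alpha> + 1)) * z ^ k"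
      by (simp only:) (simp only: algebra_simps)
    then show ?thesis unfolding c .
  qed
  ultimately have "(\<lambda>k. ?c \<alpha> k * z ^ k) sums
      ((\<alpha> + 1) * Bessel_series (\<alpha> + 1) z + z * Bessel_series (\<alpha> + 2) z)" by simp
  with s[OF assms] show ?thesis by (rule sums_unique2)
qed

lemma Bessel_I_eq_series:
  fixes \<alpha> x :: real
  assumes "\<alpha> > -1" "x \<ge> 0"
  shows "Bessel_I \<alpha> x = (x / 2) powr \<alpha> * Bessel_series \<alpha> ((x / 2)\<^sup>2)"
proof -
  have eq: "(x / 2) powr (2 * real k + \<alpha>) / (fact k * Gamma (real k + \<alpha> + 1))
      = (x / 2) powr \<alpha> * (1 / (fact k * Gamma (real k + \<alpha> + 1)) * ((x / 2)\<^sup>2) ^ k)" for k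
  proof (cases "x = 0")
    case False
    then have "(x / 2) powr (2 * real k) = ((x / 2)\<^sup>2) ^ k"
      using assms powr_realpow[of "x / 2" "2 * k"] by (simp add: power_mult)
    then show ?thesis by (simp add: powr_add)
  qed simp
  show ?thesis
    unfolding Bessel_I_def Bessel_series_def eq
    by (rule suminf_mult[OF summable_Bessel_series[OF assms(1)]])
qed

lemma Bessel_I_pos:
  fixes \<alpha> x :: real
  assumes "\<alpha> > -1" "x > 0"
  shows "Bessel_I \<alpha> x > 0"
  using assms Bessel_series_pos[of \<alpha> "(x / 2)\<^sup>2"] by (simp add: Bessel_I_eq_series)

lemma Bessel_I_recurrence:
  fixes \<alpha> x :: real
  assumes "\<alpha> > -1" "x > 0"
  shows "Bessel_I \<alpha> x = Bessel_I (\<alpha> + 2) x + 2 * (\<alpha> + 1) / x * Bessel_I (\<alpha> + 1) x"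
proof -
  have "(x / 2) powr (\<alpha> + 2) = (x / 2) powr \<alpha> * (x / 2)\<^sup>2"
    "(x / 2) powr (\<alpha> + 1) = (x / 2) powr \<alpha> * (x / 2)"
    using assms by (simp_all add: powr_add)
  then have "Bessel_I (\<alpha> + 2) x + 2 * (\<alpha> + 1) / x * Bessel_I (\<alpha> + 1) x
      = (x / 2) powr \<alpha> * ((\<alpha> + 1) * Bessel_series (\<alpha> + 1) ((x / 2)\<^sup>2)
          + (x / 2)\<^sup>2 * Bessel_series (\<alpha> + 2) ((x / 2)\<^sup>2))"
    using assms by (simp only: Bessel_I_eq_series) (simp add: algebra_simps add_divide_distrib)
  then show ?thesis
    using assms by (simp add: Bessel_I_eq_series flip: Bessel_series_recurrence)
qed

lemma DERIV_Bessel_I: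
  fixes \<alpha> x :: real
  assumes "\<alpha> > -1" "x > 0"
  shows "(Bessel_I \<alpha> has_real_derivative \<alpha> / x * Bessel_I \<alpha> x + Bessel_I (\<alpha> + 1) x) (at x)"
proof -
  have d: "((\<lambda>x. Bessel_series \<alpha> ((x / 2)\<^sup>2)) has_real_derivative
      Bessel_series (\<alpha> + 1) ((x / 2)\<^sup>2) * (x / 2)) (at x)"
    by (rule DERIV_chain2[OF DERIV_Bessel_series[OF assms(1)]])
       (auto intro!: derivative_eq_intros)
  have "((\<lambda>x. (x / 2) powr \<alpha> * Bessel_series \<alpha> ((x / 2)\<^sup>2)) has_real_derivative
      \<alpha> / x * Bessel_I \<alpha> x + Bessel_I (\<alpha> + 1) x) (at x)"
    by (rule derivative_eq_intros d refl | use assms in \<open>simp; fail\<close>)+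
       (use assms in \<open>simp add: Bessel_I_eq_series powr_add powr_diff field_simps\<close>)
  then show ?thesis
    by (rule has_field_derivative_transform_within_open[where S = "{0<..}"])
       (use assms in \<open>auto simp: Bessel_I_eq_series\<close>)
qed

text \<open>
  Up to an entire factor, the function is \<open>t powr (p + \<alpha>)\<close>. Continuity at the origin uses
  \<open>0 powr r = 0\<close>, which for a positive exponent is the limit.
\<close>
lemma continuous_on_powr_mult_Bessel_I:
  fixes \<alpha> p :: real
  assumes "\<alpha> > -1" "p + \<alpha> > 0"
  shows "continuous_on {0..} (\<lambda>t. t powr p * Bessel_I \<alpha> t)"
proof -
  have "continuous_on UNIV (Bessel_series \<alpha>)"
    using DERIV_Bessel_series[OF assms(1)] by (intro DERIV_continuous_on) auto
  then have "continuous_on {0..} (\<lambda>t. Bessel_series \<alpha> ((t / 2)\<^sup>2))"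
    by (rule continuous_on_compose2) (auto intro!: continuous_intros)
  then have "continuous_on {0..} (\<lambda>t. t powr (p + \<alpha>) / 2 powr \<alpha> * Bessel_series \<alpha> ((t / 2)\<^sup>2))"
    using assms by (auto intro!: continuous_intros continuous_on_powr')
  moreover have "t powr p * Bessel_I \<alpha> t = t powr (p + \<alpha>) / 2 powr \<alpha> * Bessel_series \<alpha> ((t / 2)\<^sup>2)"
    if "t \<in> {0..}" for t
    using that assms by (simp add: Bessel_I_eq_series powr_add powr_divide)
  ultimately show ?thesis by (rule continuous_on_eq[OF _ sym])
qed

text \<open>
  With \<open>D = Bessel_I \<alpha> - Bessel_I (\<alpha> + 1)\<close>, the derivative formula and the recurrence give
  \<open>D' + D = \<alpha> / t * Bessel_I \<alpha> + (\<alpha> + 1) / t * Bessel_I (\<alpha> + 1) \<ge> 0\<close>. So \<open>exp t * D t\<close>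
  is increasing, and it starts from \<open>0\<close> because \<open>\<alpha> > 0\<close>.
\<close>
lemma Bessel_I_Suc_order_le:
  fixes \<alpha> x :: real
  assumes "\<alpha> > 0" "x > 0"
  shows "Bessel_I (\<alpha> + 1) x \<le> Bessel_I \<alpha> x"
proof -
  let ?D = "\<lambda>t. exp t * (Bessel_I \<alpha> t - Bessel_I (\<alpha> + 1) t)"
  let ?D' = "\<lambda>t. exp t * (\<alpha> / t * Bessel_I \<alpha> t + (\<alpha> + 1) / t * Bessel_I (\<alpha> + 1) t)"
  have deriv: "(?D has_real_derivative ?D' t) (at t)" if "t > 0" for t
  proof -
    have d1: "(Bessel_I \<alpha> has_real_derivative \<alpha> / t * Bessel_I \<alpha> t + Bessel_I (\<alpha> + 1) t) (at t)"
      using DERIV_Bessel_I[of \<alpha> t] assms that by simp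
    have d2: "(Bessel_I (\<alpha> + 1) has_real_derivative
        (\<alpha> + 1) / t * Bessel_I (\<alpha> + 1) t + Bessel_I (\<alpha> + 2) t) (at t)"
      using DERIV_Bessel_I[of "\<alpha> + 1" t] assms that by (simp add: add_ac)
    have r: "Bessel_I \<alpha> t = Bessel_I (\<alpha> + 2) t + 2 * (\<alpha> + 1) / t * Bessel_I (\<alpha> + 1) t"
      using Bessel_I_recurrence[of \<alpha> t] assms that by simp
    have e: "?D' t = exp t * (Bessel_I \<alpha> t - Bessel_I (\<alpha> + 1) t)
        + ((\<alpha> / t * Bessel_I \<alpha> t + Bessel_I (\<alpha> + 1) t)
         - ((\<alpha> + 1) / t * Bessel_I (\<alpha> + 1) t + Bessel_I (\<alpha> + 2) t)) * exp t"
      using r by (simp add: algebra_simps add_divide_distrib)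
    show ?thesis unfolding e by (intro DERIV_mult DERIV_exp DERIV_diff d1 d2)
  qed
  have cont: "continuous_on {0..x} (Bessel_I \<beta>)" if "\<beta> > 0" for \<beta>
  proof (rule continuous_on_eq)
    show "continuous_on {0..x} (\<lambda>t. t powr 0 * Bessel_I \<beta> t)"
      using continuous_on_powr_mult_Bessel_I[of \<beta> 0] that
      by (auto intro: continuous_on_subset)
    show "t powr 0 * Bessel_I \<beta> t = Bessel_I \<beta> t" if "t \<in> {0..x}" for t
      using \<open>\<beta> > 0\<close> by (cases "t = 0") (simp_all add: Bessel_I_eq_series)
  qed
  have "?D 0 \<le> ?D x"
  proof (rule DERIV_nonneg_imp_increasing_open[where f = ?D])
    show "0 \<le> x" using assms by simp
    show "continuous_on {0..x} ?D"
      using assms by (intro continuous_intros cont) auto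
    show "\<exists>y. (?D has_real_derivative y) (at t) \<and> 0 \<le> y" if "0 < t" "t < x" for t
      using deriv[OF \<open>0 < t\<close>] Bessel_I_pos[of \<alpha> t] Bessel_I_pos[of "\<alpha> + 1" t] assms that
      by (intro exI[of _ "?D' t"] conjI mult_nonneg_nonneg add_nonneg_nonneg) auto
  qed
  moreover have "?D 0 = 0" using assms by (simp add: Bessel_I_eq_series)
  ultimately show ?thesis by (simp add: zero_le_mult_iff)
qed

text \<open>
  Replace \<open>Bessel_I (\<nu> + 2)\<close> by the larger \<open>Bessel_I (\<nu> + 1)\<close> in the recurrence for \<open>Bessel_I \<nu>\<close>.
\<close>
lemma Bessel_I_ratio_lower:
  fixes \<nu> x :: real
  assumes "\<nu> > -1" "x > 0"
  shows "x / (x + 2 * \<nu> + 2) * Bessel_I \<nu> x \<le> Bessel_I (\<nu> + 1) x"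
proof -
  have "Bessel_I (\<nu> + 2) x \<le> Bessel_I (\<nu> + 1) x"
    using Bessel_I_Suc_order_le[of "\<nu> + 1" x] assms by (simp add: add_ac)
  then have "Bessel_I \<nu> x \<le> (1 + 2 * (\<nu> + 1) / x) * Bessel_I (\<nu> + 1) x"
    using Bessel_I_recurrence[of \<nu> x] assms by (simp add: algebra_simps)
  then show ?thesis using assms by (simp add: field_simps)
qed

section \<open>Integrals bounded through an antiderivative\<close>

text \<open>
  Stated with the initial value on the left, so that bounds over adjacent intervals chain by
  transitivity, without truncated subtraction of extended nonnegative reals.
\<close>
lemma nn_integral_le_FTC:
  fixes f g G :: "real \<Rightarrow> real" and a b :: real
  assumes "a \<le> b" "continuous_on {a..b} G" "0 \<le> G a"
    and "\<And>t. a < t \<Longrightarrow> t < b \<Longrightarrow> (G has_real_derivative g t) (at t)"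
    and "\<And>t. a < t \<Longrightarrow> t < b \<Longrightarrow> 0 \<le> f t"
    and "\<And>t. a < t \<Longrightarrow> t < b \<Longrightarrow> f t \<le> g t"
  shows "ennreal (G a) + (\<integral>\<^sup>+t\<in>{a<..<b}. ennreal (f t) \<partial>lebesgue) \<le> ennreal (G b)"
proof -
  \<comment> \<open>Nothing is known about \<open>g\<close> at the end points, where it is replaced by \<open>0\<close>.\<close>
  define h where "h t = (if a < t \<and> t < b then g t else 0)" for t
  have h0: "0 \<le> h t" for t using assms(5,6)[of t] by (auto simp: h_def)
  have h: "(h has_integral G b - G a) {a..b}"
    using assms unfolding h_def
    by (intro fundamental_theorem_of_calculus_interior)
       (auto simp: has_real_derivative_iff_has_vector_derivative[symmetric])
  have "0 \<le> G b - G a" using has_integral_nonneg[OF h] h0 by simp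
  have "(\<integral>\<^sup>+t\<in>{a<..<b}. ennreal (f t) \<partial>lebesgue) \<le> (\<integral>\<^sup>+t. ennreal (indicator {a..b} t * h t) \<partial>lebesgue)"
    using assms by (intro nn_integral_mono) (auto simp: h_def indicator_def intro!: ennreal_leI)
  also have "\<dots> = ennreal (G b - G a)"
    using nn_integral_has_integral_lebesgue[OF h0 h] by (simp add: nn_integral_completion)
  finally have "ennreal (G a) + (\<integral>\<^sup>+t\<in>{a<..<b}. ennreal (f t) \<partial>lebesgue)
      \<le> ennreal (G a) + ennreal (G b - G a)"
    by (rule add_left_mono)
  also have "\<dots> = ennreal (G b)"
    using \<open>0 \<le> G b - G a\<close> assms(3) by (simp flip: ennreal_plus)
  finally show ?thesis .
qed

lemma DERIV_exp_powr_Bessel_I: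
  fixes a q \<mu> t :: real
  assumes "\<mu> > -1" "t > 0"
  shows "((\<lambda>t. exp (- a * t) * (t powr (q - \<mu>) * Bessel_I (\<mu> + 1) t)) has_real_derivative
    exp (- a * t) * t powr (q - \<mu>) * (Bessel_I (\<mu> + 2) t + ((q + 1) / t - a) * Bessel_I (\<mu> + 1) t)) (at t)"
proof -
  have d: "(Bessel_I (\<mu> + 1) has_real_derivative
      (\<mu> + 1) / t * Bessel_I (\<mu> + 1) t + Bessel_I (\<mu> + 2) t) (at t)"
    using DERIV_Bessel_I[of "\<mu> + 1" t] assms by (simp add: add_ac)
  have dexp: "((\<lambda>t. exp (- a * t)) has_real_derivative - a * exp (- a * t)) (at t)"
    by (auto intro!: derivative_eq_intros)
  have dpowr: "((\<lambda>t. t powr (q - \<mu>)) has_real_derivative (q - \<mu>) / t * t powr (q - \<mu>)) (at t)"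
    using has_real_derivative_powr[of t "q - \<mu>"] assms by (simp add: powr_diff mult.commute)
  have e: "exp (- a * t) * t powr (q - \<mu>) * (Bessel_I (\<mu> + 2) t + ((q + 1) / t - a) * Bessel_I (\<mu> + 1) t)
      = - a * exp (- a * t) * (t powr (q - \<mu>) * Bessel_I (\<mu> + 1) t)
        + ((q - \<mu>) / t * t powr (q - \<mu>) * Bessel_I (\<mu> + 1) t
           + ((\<mu> + 1) / t * Bessel_I (\<mu> + 1) t + Bessel_I (\<mu> + 2) t) * t powr (q - \<mu>)) * exp (- a * t)"
    by (simp add: algebra_simps add_divide_distrib diff_divide_distrib)
  show ?thesis
    unfolding e by (intro DERIV_mult d dexp dpowr)
qed

text \<open>
  The exponent \<open>a0\<close> of the antiderivative may be smaller than that of the integrand: \<open>a0 = a\<close>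
  serves for large \<open>t\<close>, and \<open>a0 = 0\<close> for small \<open>t\<close>.
\<close>
lemma nn_integral_exp_powr_Bessel_I_le:
  fixes a a0 q \<mu> C s x :: real
  assumes "\<mu> > -1" "q > -1" "0 \<le> s" "s \<le> x" "a0 \<le> a" "0 \<le> C"
    and dominated: "\<And>t. s < t \<Longrightarrow> t < x \<Longrightarrow>
      Bessel_I \<mu> t \<le> C * (Bessel_I (\<mu> + 2) t + ((q + 1) / t - a0) * Bessel_I (\<mu> + 1) t)"
  shows "ennreal (C * (exp (- a0 * s) * (s powr (q - \<mu>) * Bessel_I (\<mu> + 1) s)))
      + (\<integral>\<^sup>+t\<in>{s<..<x}. ennreal (exp (- a * t) * (t powr (q - \<mu>) * Bessel_I \<mu> t)) \<partial>lebesgue)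
    \<le> ennreal (C * (exp (- a0 * x) * (x powr (q - \<mu>) * Bessel_I (\<mu> + 1) x)))"
proof (rule nn_integral_le_FTC[OF \<open>s \<le> x\<close>])
  show "continuous_on {s..x} (\<lambda>t. C * (exp (- a0 * t) * (t powr (q - \<mu>) * Bessel_I (\<mu> + 1) t)))"
    using assms
    by (intro continuous_intros continuous_on_subset[OF continuous_on_powr_mult_Bessel_I]) auto
  show "0 \<le> C * (exp (- a0 * s) * (s powr (q - \<mu>) * Bessel_I (\<mu> + 1) s))"
    using assms Bessel_I_pos[of "\<mu> + 1" s] by (cases "s = 0") auto
  fix t assume t: "s < t" "t < x"
  then have "t > 0" using assms by simp
  then show "((\<lambda>t. C * (exp (- a0 * t) * (t powr (q - \<mu>) * Bessel_I (\<mu> + 1) t))) has_real_derivative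
      C * (exp (- a0 * t) * t powr (q - \<mu>) * (Bessel_I (\<mu> + 2) t + ((q + 1) / t - a0) * Bessel_I (\<mu> + 1) t))) (at t)"
    using DERIV_exp_powr_Bessel_I assms by (intro DERIV_cmult) auto
  have p: "Bessel_I \<mu> t > 0" using Bessel_I_pos assms \<open>t > 0\<close> by simp
  then show "0 \<le> exp (- a * t) * (t powr (q - \<mu>) * Bessel_I \<mu> t)" by simp
  have "exp (- a * t) * (t powr (q - \<mu>) * Bessel_I \<mu> t) \<le> exp (- a0 * t) * (t powr (q - \<mu>) * Bessel_I \<mu> t)"
    using p assms \<open>t > 0\<close> by (intro mult_right_mono) auto
  also have "\<dots> \<le> exp (- a0 * t) * (t powr (q - \<mu>) *
      (C * (Bessel_I (\<mu> + 2) t + ((q + 1) / t - a0) * Bessel_I (\<mu> + 1) t)))"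
    by (intro mult_left_mono dominated t) auto
  finally show "exp (- a * t) * (t powr (q - \<mu>) * Bessel_I \<mu> t)
     \<le> C * (exp (- a0 * t) * t powr (q - \<mu>) * (Bessel_I (\<mu> + 2) t + ((q + 1) / t - a0) * Bessel_I (\<mu> + 1) t))"
    by (simp add: mult_ac)
qed

section \<open>The inequality for power weights\<close>

text \<open>
  The two numbers in the maximum \<open>K_const \<mu> q\<close> are the ratios of the coefficients of
  \<open>Bessel_I (\<mu> + 2) t\<close> and of \<open>Bessel_I (\<mu> + 1) t / t\<close>, in \<open>Bessel_I \<mu> t\<close> (expanded by the
  recurrence) and in the derivative of \<open>t powr (q - \<mu>) * Bessel_I (\<mu> + 1) t\<close>.
\<close>
lemma nn_integral_power_weight_small:
  fixes a q \<mu> x :: real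
  assumes "\<mu> > -1" "q > -1" "0 \<le> a" "0 \<le> x"
  shows "(\<integral>\<^sup>+t\<in>{0<..<x}. ennreal (exp (- a * t) * (t powr (q - \<mu>) * Bessel_I \<mu> t)) \<partial>lebesgue)
    \<le> ennreal (K_const \<mu> q * (x powr (q - \<mu>) * Bessel_I (\<mu> + 1) x))"
proof -
  have K: "1 \<le> K_const \<mu> q" "2 * (\<mu> + 1) \<le> K_const \<mu> q * (q + 1)"
    using assms by (auto simp: K_const_def simp flip: pos_divide_le_eq)
  have "Bessel_I \<mu> t \<le> K_const \<mu> q * (Bessel_I (\<mu> + 2) t + ((q + 1) / t - 0) * Bessel_I (\<mu> + 1) t)"
    if "t > 0" for t
  proof -
    have p: "Bessel_I (\<mu> + 2) t > 0" "Bessel_I (\<mu> + 1) t > 0"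
      using Bessel_I_pos assms that by auto
    have "1 * Bessel_I (\<mu> + 2) t \<le> K_const \<mu> q * Bessel_I (\<mu> + 2) t"
      using K p by (intro mult_right_mono) auto
    moreover have "2 * (\<mu> + 1) * (Bessel_I (\<mu> + 1) t / t)
        \<le> K_const \<mu> q * (q + 1) * (Bessel_I (\<mu> + 1) t / t)"
      using K p that by (intro mult_right_mono) auto
    ultimately show ?thesis
      using Bessel_I_recurrence[of \<mu> t] assms that
      by (simp add: algebra_simps add_divide_distrib)
  qed
  then show ?thesis
    using nn_integral_exp_powr_Bessel_I_le[of \<mu> q 0 x 0 a "K_const \<mu> q"] assms K(1) by simp
qed

text \<open>
  The hypothesis on \<open>X\<close> says that \<open>\<theta> \<le> X / (X + 2 * (\<mu> + 1) + 2)\<close>, the ratio bound at order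
  \<open>\<mu> + 1\<close>. So \<open>Bessel_I (\<mu> + 2) t\<close> exceeds the negative term by at least
  \<open>(\<theta> - a) * Bessel_I (\<mu> + 1) t\<close>, and the ratio bound at order \<open>\<mu>\<close> finishes.
\<close>
lemma exp_powr_Bessel_I_derivative_bound:
  fixes a q \<mu> \<theta> X t :: real
  assumes "\<mu> > -1" "q > -1" "a < \<theta>" "\<theta> < 1" "0 < X" "2 * (\<mu> + 2) * \<theta> / (1 - \<theta>) \<le> X" "X \<le> t"
  shows "X / (X + 2 * \<mu> + 2) * (\<theta> - a) * Bessel_I \<mu> t
    \<le> Bessel_I (\<mu> + 2) t + ((q + 1) / t - a) * Bessel_I (\<mu> + 1) t"
proof -
  have "t > 0" using assms by simp
  have p: "Bessel_I \<mu> t > 0" "Bessel_I (\<mu> + 1) t > 0"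
    using Bessel_I_pos assms \<open>t > 0\<close> by auto
  have \<theta>: "\<theta> \<le> t / (t + 2 * (\<mu> + 1) + 2)"
  proof -
    have "2 * (\<mu> + 2) * \<theta> \<le> X * (1 - \<theta>)" using assms by (simp add: pos_divide_le_eq)
    also have "\<dots> \<le> t * (1 - \<theta>)" using assms by (intro mult_right_mono) auto
    finally show ?thesis using assms \<open>t > 0\<close> by (simp add: pos_le_divide_eq algebra_simps)
  qed
  have "\<theta> * Bessel_I (\<mu> + 1) t \<le> t / (t + 2 * (\<mu> + 1) + 2) * Bessel_I (\<mu> + 1) t"
    using p \<theta> by (intro mult_right_mono) auto
  also have "\<dots> \<le> Bessel_I (\<mu> + 2) t"
    using Bessel_I_ratio_lower[of "\<mu> + 1" t] assms \<open>t > 0\<close> by (simp add: add_ac)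
  finally have 1: "\<theta> * Bessel_I (\<mu> + 1) t \<le> Bessel_I (\<mu> + 2) t" .
  have "X * (2 * \<mu> + 2) \<le> t * (2 * \<mu> + 2)"
    using assms by (intro mult_right_mono) auto
  then have "X * (t + 2 * \<mu> + 2) \<le> t * (X + 2 * \<mu> + 2)"
    by (simp add: algebra_simps)
  then have "X / (X + 2 * \<mu> + 2) \<le> t / (t + 2 * \<mu> + 2)"
    using assms \<open>t > 0\<close> by (simp add: divide_le_eq le_divide_eq mult.commute)
  then have "X / (X + 2 * \<mu> + 2) * Bessel_I \<mu> t \<le> t / (t + 2 * \<mu> + 2) * Bessel_I \<mu> t"
    using p by (intro mult_right_mono) auto
  also have "\<dots> \<le> Bessel_I (\<mu> + 1) t"
    using Bessel_I_ratio_lower assms \<open>t > 0\<close> by simp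
  finally have "(X / (X + 2 * \<mu> + 2) * Bessel_I \<mu> t) * (\<theta> - a) \<le> Bessel_I (\<mu> + 1) t * (\<theta> - a)"
    using assms by (intro mult_right_mono) auto
  moreover have "0 \<le> (q + 1) / t * Bessel_I (\<mu> + 1) t"
    using p assms \<open>t > 0\<close> by simp
  ultimately show ?thesis using 1 by (simp add: algebra_simps)
qed

lemma borel_measurable_exp_powr_Bessel_I:
  fixes a p \<mu> :: real
  assumes "\<mu> > -1" "A \<subseteq> {0<..}" "A \<in> sets borel"
  shows "(\<lambda>t. ennreal (exp (- a * t) * (t powr p * Bessel_I \<mu> t)) * indicator A t)
    \<in> borel_measurable lebesgue"
proof -
  have "continuous_on A (Bessel_I \<mu>)"
    using DERIV_Bessel_I assms(1,2) by (intro DERIV_continuous_on) (blast intro: has_field_derivative_at_within)+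
  then have "continuous_on A (\<lambda>t. exp (- a * t) * (t powr p * Bessel_I \<mu> t))"
    using assms(2) by (intro continuous_intros) auto
  then have "(\<lambda>t. indicator A t *\<^sub>R (exp (- a * t) * (t powr p * Bessel_I \<mu> t))) \<in> borel_measurable borel"
    using assms(3) by (intro borel_measurable_continuous_on_indicator)
  then have "(\<lambda>t. ennreal (indicator A t *\<^sub>R (exp (- a * t) * (t powr p * Bessel_I \<mu> t))))
      \<in> borel_measurable lborel" by simp
  then have "(\<lambda>t. ennreal (indicator A t *\<^sub>R (exp (- a * t) * (t powr p * Bessel_I \<mu> t))))
      \<in> borel_measurable lebesgue" by (rule measurable_completion)
  moreover have "(\<lambda>t. ennreal (indicator A t *\<^sub>R (exp (- a * t) * (t powr p * Bessel_I \<mu> t))))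
      = (\<lambda>t. ennreal (exp (- a * t) * (t powr p * Bessel_I \<mu> t)) * indicator A t)"
    by (auto simp: fun_eq_iff indicator_def)
  ultimately show ?thesis by simp
qed

text \<open>
  The theorem for \<open>w t = t powr q\<close>, with \<open>\<gamma> + \<eta>\<close> in place of \<open>\<gamma>\<close>. For \<open>x > X\<close> the bound for small
  arguments, taken at \<open>X\<close>, supplies the initial value from which the antiderivative continues.
\<close>
lemma nn_integral_power_weight:
  fixes a q \<mu> \<theta> X M x :: real
  assumes "\<mu> > -1" "q > -1" "0 \<le> a" "a < \<theta>" "\<theta> < 1" "0 < X" "2 * (\<mu> + 2) * \<theta> / (1 - \<theta>) \<le> X"
    and M1: "K_const \<mu> q * exp (a * X) \<le> M"
    and M2: "1 / (X / (X + 2 * \<mu> + 2) * (\<theta> - a)) \<le> M"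
    and "x > 0"
  shows "(\<integral>\<^sup>+t\<in>{0<..<x}. ennreal (exp (- a * t) * (t powr (q - \<mu>) * Bessel_I \<mu> t)) \<partial>lebesgue)
    \<le> ennreal (M * (exp (- a * x) * (x powr (q - \<mu>) * Bessel_I (\<mu> + 1) x)))"
proof -
  define f where "f t = ennreal (exp (- a * t) * (t powr (q - \<mu>) * Bessel_I \<mu> t))" for t
  define G where "G t = exp (- a * t) * (t powr (q - \<mu>) * Bessel_I (\<mu> + 1) t)" for t
  have K: "1 \<le> K_const \<mu> q" by (simp add: K_const_def)
  have "0 < K_const \<mu> q * exp (a * X)" using K by (intro mult_pos_pos) auto
  with M1 have "M > 0" by linarith
  have Gpos: "G t > 0" if "t > 0" for t
    using Bessel_I_pos[of "\<mu> + 1" t] assms that by (simp add: G_def)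
  have small: "(\<integral>\<^sup>+t\<in>{0<..<y}. f t \<partial>lebesgue) \<le> ennreal (M * G y)" if y: "0 < y" "y \<le> X" for y
  proof -
    have e: "exp (a * y) * exp (- (a * y)) = 1" by (simp flip: exp_add)
    have "(\<integral>\<^sup>+t\<in>{0<..<y}. f t \<partial>lebesgue) \<le> ennreal (K_const \<mu> q * (y powr (q - \<mu>) * Bessel_I (\<mu> + 1) y))"
      unfolding f_def using assms y by (intro nn_integral_power_weight_small) auto
    also have "K_const \<mu> q * (y powr (q - \<mu>) * Bessel_I (\<mu> + 1) y) = K_const \<mu> q * exp (a * y) * G y"
      using e by (simp add: G_def)
    also have "\<dots> \<le> K_const \<mu> q * exp (a * X) * G y"
      using K Gpos[OF y(1)] y assms by (intro mult_right_mono mult_left_mono) (auto intro: mult_left_mono)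
    also have "\<dots> \<le> M * G y" using M1 Gpos[OF y(1)] by (intro mult_right_mono) auto
    finally show ?thesis by (auto intro: ennreal_leI)
  qed
  show ?thesis
  proof (cases "x \<le> X")
    case True
    then show ?thesis using small[of x] assms by (simp add: f_def G_def)
  next
    case False
    have b: "0 < X / (X + 2 * \<mu> + 2) * (\<theta> - a)" using assms by simp
    have "Bessel_I \<mu> t \<le> M * (Bessel_I (\<mu> + 2) t + ((q + 1) / t - a) * Bessel_I (\<mu> + 1) t)"
      if t: "X < t" for t
    proof -
      have "1 * Bessel_I \<mu> t \<le> (M * (X / (X + 2 * \<mu> + 2) * (\<theta> - a))) * Bessel_I \<mu> t"
        using M2 b Bessel_I_pos[of \<mu> t] assms t
        by (intro mult_right_mono) (simp_all add: pos_divide_le_eq)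
      also have "\<dots> = M * (X / (X + 2 * \<mu> + 2) * (\<theta> - a) * Bessel_I \<mu> t)" by simp
      also have "\<dots> \<le> M * (Bessel_I (\<mu> + 2) t + ((q + 1) / t - a) * Bessel_I (\<mu> + 1) t)"
        using \<open>M > 0\<close> assms t by (intro mult_left_mono exp_powr_Bessel_I_derivative_bound) auto
      finally show ?thesis by simp
    qed
    then have large: "ennreal (M * G X) + (\<integral>\<^sup>+t\<in>{X<..<x}. f t \<partial>lebesgue) \<le> ennreal (M * G x)"
      unfolding f_def G_def using assms False \<open>M > 0\<close>
      by (intro nn_integral_exp_powr_Bessel_I_le) auto
    have "(\<integral>\<^sup>+t\<in>{0<..<x}. f t \<partial>lebesgue) = (\<integral>\<^sup>+t. f t * indicator {0<..<X} t + f t * indicator {X<..<x} t \<partial>lebesgue)"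
    proof (rule nn_integral_cong_AE)
      have "AE t in lebesgue. t \<noteq> X"
        by (rule AE_I'[of "{X}"]) auto
      then show "AE t in lebesgue. f t * indicator {0<..<x} t = f t * indicator {0<..<X} t + f t * indicator {X<..<x} t"
        by (rule eventually_mono) (use False \<open>X > 0\<close> in \<open>auto simp: indicator_def\<close>)
    qed
    also have "\<dots> = (\<integral>\<^sup>+t\<in>{0<..<X}. f t \<partial>lebesgue) + (\<integral>\<^sup>+t\<in>{X<..<x}. f t \<partial>lebesgue)"
      unfolding f_def using assms
      by (intro nn_integral_add borel_measurable_exp_powr_Bessel_I) auto
    also have "\<dots> \<le> ennreal (M * G X) + (\<integral>\<^sup>+t\<in>{X<..<x}. f t \<partial>lebesgue)"
      using small[of X] assms by (intro add_right_mono) auto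
    also note large
    finally show ?thesis by (simp add: f_def G_def)
  qed
qed

section \<open>The inequality for the weight class\<close>

theorem theorem3p6:
  fixes \<mu> q \<gamma> \<eta> \<theta> x :: real and w :: "real \<Rightarrow> real"
  assumes "\<mu> > -1" and "q > -1"
    and "0 < \<gamma>" and "\<gamma> < 1"
    and "0 \<le> \<eta>" and "\<eta> < 1 - \<gamma>"
    and "w \<in> weight_class q \<eta>"
    and "\<gamma> + \<eta> < \<theta>" and "\<theta> < 1"
    and "x > 0"
  shows "(\<integral>\<^sup>+t\<in>{0<..<x}. ennreal (exp (- \<gamma> * t) * w t * t powr (- \<mu>) * Bessel_I \<mu> t) \<partial>lebesgue)
       \<le> ennreal (M_const \<eta> \<mu> q \<gamma> \<theta> * (exp (- \<gamma> * x) * w x * x powr (- \<mu>) * Bessel_I (\<mu> + 1) x))"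
proof -
  define a where "a = \<gamma> + \<eta>"
  define X where "X = X_fun \<mu> q \<theta>"
  define M where "M = M_const \<eta> \<mu> q \<gamma> \<theta>"
  \<comment> \<open>The factor common to both sides once \<open>w\<close> is compared with \<open>t powr q\<close>.\<close>
  define C where "C = exp (\<eta> * x) * w x / x powr q"
  define f where "f t = exp (- a * t) * (t powr (q - \<mu>) * Bessel_I \<mu> t)" for t
  have w: "w t > 0" if "t > 0" for t
    using assms that by (simp add: weight_class_def)
  have wle: "w t / t powr q \<le> exp (\<eta> * (x - t)) * (w x / x powr q)" if "0 < t" "t \<le> x" for t
    using assms that by (simp add: weight_class_def)
  have X: "2 * (\<mu> + 2) * \<theta> / (1 - \<theta>) \<le> X" by (simp add: X_def X_fun_def)
  moreover have "0 < 2 * (\<mu> + 2) * \<theta> / (1 - \<theta>)" using assms by simp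
  ultimately have "X > 0" by linarith
  have C: "C > 0" using w assms by (simp add: C_def)
  have "exp (- \<gamma> * t) * w t * t powr (- \<mu>) * Bessel_I \<mu> t \<le> C * f t" if t: "0 < t" "t < x" for t
  proof -
    have "w t \<le> exp (\<eta> * (x - t)) * (w x / x powr q) * t powr q"
      using wle[of t] t by (simp add: field_simps)
    then have "exp (- \<gamma> * t) * w t * t powr (- \<mu>) * Bessel_I \<mu> t
        \<le> exp (- \<gamma> * t) * (exp (\<eta> * (x - t)) * (w x / x powr q) * t powr q) * t powr (- \<mu>) * Bessel_I \<mu> t"
      using Bessel_I_pos[of \<mu> t] assms t by (intro mult_right_mono mult_left_mono) auto
    also have "\<dots> = C * f t"
      unfolding C_def f_def a_def
      by (simp add: powr_diff powr_minus exp_add exp_diff exp_minus field_simps)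
    finally show ?thesis .
  qed
  then have "(\<integral>\<^sup>+t\<in>{0<..<x}. ennreal (exp (- \<gamma> * t) * w t * t powr (- \<mu>) * Bessel_I \<mu> t) \<partial>lebesgue)
      \<le> (\<integral>\<^sup>+t. ennreal C * (ennreal (f t) * indicator {0<..<x} t) \<partial>lebesgue)"
    using C by (intro nn_integral_mono) (auto simp: indicator_def simp flip: ennreal_mult' intro!: ennreal_leI)
  also have "\<dots> = ennreal C * (\<integral>\<^sup>+t\<in>{0<..<x}. ennreal (f t) \<partial>lebesgue)"
    unfolding f_def using assms by (intro nn_integral_cmult borel_measurable_exp_powr_Bessel_I) auto
  also have "\<dots> \<le> ennreal C * ennreal (M * (exp (- a * x) * (x powr (q - \<mu>) * Bessel_I (\<mu> + 1) x)))"
    unfolding f_def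
    using assms X \<open>X > 0\<close>
    by (intro mult_left_mono nn_integral_power_weight[where X = X and \<theta> = \<theta>])
       (auto simp: a_def M_def M_const_def X_def beta_fun_def algebra_simps)
  also have "\<dots> = ennreal (M * (exp (- \<gamma> * x) * w x * x powr (- \<mu>) * Bessel_I (\<mu> + 1) x))"
    using C assms unfolding C_def a_def
    by (simp add: powr_diff powr_minus exp_add exp_diff exp_minus field_simps flip: ennreal_mult')
  finally show ?thesis unfolding M_def .
qed

end
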